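(* Let $f_1$ and $f_1^*$ be the hidden variable recurrent fractal interpolation functions, constructed as in the context, for the data set $P=\{(x_i,y_i,z_i)\}_{i=0}^n$ and for the perturbed data set $P_{x^*}=\{(x_i^*,y_i,z_i)\}_{i=0}^n$ respectively, where $0=x_0=x_0^*<x_1^*<\dots<x_n^*=x_n=1$. Suppose $$\omega+\tilde\omega<\frac{l_L}{L_L}.$$ Let $L_1,L_2>0$ be constants such that, for some $\tau_1,\tau_2\in(0,1]$, $|f_1(u)-f_1(v)|\le L_1|u-v|^{\tau_1}$ and $|f_2(u)-f_2(v)|\le L_2|u-v|^{\tau_2}$ for all $u,v\in I$. Then there exist constants $N$ and $\tau$ with $0<\tau\le 1$ such that $$\|f_1-f_1^*\|_\infty\le\frac{L_1(1+\omega-\tilde\omega)+2\omega L_2+\omega N}{1-\omega-\tilde\omega}\,\max_i|x_i-x_i^*|^{\tau}.$$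
   Context: Data and intervals. Let $P=\{(x_i,y_i,z_i)\in\mathbb{R}^3: i=0,\dots,n\}$ with $0=x_0<x_1<\dots<x_n=1$, $I=[0,1]$, $I_i=[x_{i-1},x_i]$ for $i=1,\dots,n$. Let $l$ be an integer with $2\le l\le n$, and for $k=1,\dots,l$ let $\tilde I_k=[x_{s(k)},x_{e(k)}]$ with $s(k),e(k)$ node indices, $e(k)-s(k)\ge2$. For each $i\in\{1,\dots,n\}$ an index $\gamma(i)\in\{1,\dots,l\}$ is chosen. $|J|$ denotes the length of an interval $J$. Maps. For each $i$, with $k=\gamma(i)$, $L_{i,k}:\tilde I_k\to I_i$ is a contraction homeomorphism that is a similitude, with $L_{i,k}(\{x_{s(k)},x_{e(k)}\})=\{x_{i-1},x_i\}$. The functions $s_i,s'_i,\tilde s_i,\tilde s'_i:I_i\to\mathbb{R}$ are Lipschitz with absolute values less than $1$. The functions $q_{i,k},\tilde q_{i,k}:\tilde I_k\to\mathbb{R}$ are $$q_{i,k}(x)=-s_i(L_{i,k}(x))g_{i,k}(x)-s'_i(L_{i,k}(x))g'_{i,k}(x)+h_i(L_{i,k}(x)),$$ $$\tilde q_{i,k}(x)=-\tilde s_i(L_{i,k}(x))g_{i,k}(x)-\tilde s'_i(L_{i,k}(x))g'_{i,k}(x)+\tilde h_i(L_{i,k}(x)),$$ where $$g_{i,k}(x)=\frac{x-x_{s(k)}}{x_{e(k)}-x_{s(k)}}y_{e(k)}+\frac{x-x_{e(k)}}{x_{s(k)}-x_{e(k)}}y_{s(k)},\quad g'_{i,k}(x)=\frac{x-x_{s(k)}}{x_{e(k)}-x_{s(k)}}z_{e(k)}+\frac{x-x_{e(k)}}{x_{s(k)}-x_{e(k)}}z_{s(k)},$$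 $$h_i(x)=\frac{x-x_{i-1}}{x_i-x_{i-1}}y_i+\frac{x-x_i}{x_{i-1}-x_i}y_{i-1},\quad \tilde h_i(x)=\frac{x-x_{i-1}}{x_i-x_{i-1}}z_i+\frac{x-x_i}{x_{i-1}-x_i}z_{i-1}.$$ The function for $P$. $\vec f=(f_1,f_2):I\to\mathbb{R}^2$ is the unique continuous function with $\vec f(x_i)=(y_i,z_i)$ for all $i$ and, for $x\in I_i$ and $k=\gamma(i)$, $$f_1(x)=s_i(x)f_1(L_{i,k}^{-1}(x))+s'_i(x)f_2(L_{i,k}^{-1}(x))+q_{i,k}(L_{i,k}^{-1}(x)),$$ $$f_2(x)=\tilde s_i(x)f_1(L_{i,k}^{-1}(x))+\tilde s'_i(x)f_2(L_{i,k}^{-1}(x))+\tilde q_{i,k}(L_{i,k}^{-1}(x)).$$ Its first component $f_1$ is the hidden variable recurrent fractal interpolation function (HVRFIF). The function for $P_{x^*}$. Put $I_i^*=[x_{i-1}^*,x_i^*]$, $\tilde I_k^*=[x_{s(k)}^*,x_{e(k)}^*]$, and let $R:I\to I$ be the piecewise affine homeomorphism $R(x)=x_{i-1}^*+\frac{x_i^*-x_{i-1}^*}{x_i-x_{i-1}}(x-x_{i-1})$ for $x\in I_i$. Define $$L^*_{i,k}=R\circ L_{i,k}\circ R^{-1}:\tilde I_k^*\to I_i^*,\quad s_i^*=s_i\circ R^{-1},\ s_i'^*=s'_i\circ R^{-1},\ \tilde s_i^*=\tilde s_i\circ R^{-1},\ \tilde s_i'^*=\tilde s'_i\circ R^{-1},$$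 and let $q^*_{i,k},\tilde q^*_{i,k}$ be given by the formulas for $q_{i,k},\tilde q_{i,k}$ above with every $x_j$ replaced by $x_j^*$, $L_{i,k}$ by $L_{i,k}^*$, and $s_i,s'_i,\tilde s_i,\tilde s'_i$ by $s_i^*,s_i'^*,\tilde s_i^*,\tilde s_i'^*$ (the $y_j,z_j$ unchanged). Then $\vec f^*=(f_1^*,f_2^* ):I\to\mathbb{R}^2$ is the unique continuous function with $\vec f^*(x_i^* )=(y_i,z_i)$ satisfying the same functional equations with all starred objects, for $x\in I_i^*$. Notation. For a function $g$, $\overline g=\max_x|g(x)|$. $\omega_j=\max\{\overline{s_j},\overline{s'_j}\}$, $\tilde\omega_j=\max\{\overline{\tilde s_j},\overline{\tilde s'_j}\}$, $\omega=\max_j\omega_j$, $\tilde\omega=\max_j\tilde\omega_j$, $$L_L=\max_{1\le k\le n}\frac{|I_k|}{|\tilde I_{\gamma(k)}|},\qquad l_L=\min_{1\le k\le n}\frac{|I_k|}{|\tilde I_{\gamma(k)}|}.$$ $\|\cdot\|_\infty$ is the supremum norm on $I$. *)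

theory Defs
  imports "HOL-Analysis.Analysis"
begin

text \<open>
  The interpolation data together with the maps of the construction. \<open>pick D\<close> is the choice \<open>\<gamma>\<close>, and
  \<open>smap D i k\<close> only matters for \<open>k = pick D i\<close>; \<open>lo D k\<close> and \<open>hi D k\<close> are the end node indices \<open>s(k)\<close>, \<open>e(k)\<close>
  of the \<open>k\<close>-th region, and \<open>c11, c12, c21, c22\<close> are the contractivity functions:
  the first digit is the component of the vector-valued function being computed, the second one
  the component it multiplies.
\<close>

record hvr_data =
  npts :: nat
  nreg :: nat
  node :: "nat \<Rightarrow> real"
  yval :: "nat \<Rightarrow> real"
  zval :: "nat \<Rightarrow> real"
  lo :: "nat \<Rightarrow> nat"
  hi :: "nat \<Rightarrow> nat"
  pick :: "nat \<Rightarrow> nat"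
  smap :: "nat \<Rightarrow> nat \<Rightarrow> real \<Rightarrow> real"
  c11 :: "nat \<Rightarrow> real \<Rightarrow> real"
  c12 :: "nat \<Rightarrow> real \<Rightarrow> real"
  c21 :: "nat \<Rightarrow> real \<Rightarrow> real"
  c22 :: "nat \<Rightarrow> real \<Rightarrow> real"

definition unit_partition :: "nat \<Rightarrow> (nat \<Rightarrow> real) \<Rightarrow> bool" where
  "unit_partition n x \<longleftrightarrow> x 0 = 0 \<and> x n = 1 \<and> (\<forall>i\<in>{1..n}. x (i - 1) < x i)"

definition cell :: "hvr_data \<Rightarrow> nat \<Rightarrow> real set" where
  "cell D i = {node D (i - 1) .. node D i}"

definition region :: "hvr_data \<Rightarrow> nat \<Rightarrow> real set" where
  "region D k = {node D (lo D k) .. node D (hi D k)}"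

definition contractive_similitude_homeomorphism ::
    "real set \<Rightarrow> real set \<Rightarrow> (real \<Rightarrow> real) \<Rightarrow> bool" where
  "contractive_similitude_homeomorphism S T f \<longleftrightarrow>
     (\<exists>g. homeomorphism S T f g) \<and>
     (\<exists>c. 0 < c \<and> c < 1 \<and> (\<forall>u\<in>S. \<forall>v\<in>S. dist (f u) (f v) = c * dist u v))"

definition admissible_coeff :: "real set \<Rightarrow> (real \<Rightarrow> real) \<Rightarrow> bool" where
  "admissible_coeff S c \<longleftrightarrow> (\<exists>C. C-lipschitz_on S c) \<and> (\<forall>u\<in>S. \<bar>c u\<bar> < 1)"

definition hvr_system :: "hvr_data \<Rightarrow> bool" where
  "hvr_system D \<longleftrightarrow>
     unit_partition (npts D) (node D) \<and>
     2 \<le> nreg D \<and> nreg D \<le> npts D \<and>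
     (\<forall>k\<in>{1..nreg D}. lo D k + 2 \<le> hi D k \<and> hi D k \<le> npts D) \<and>
     (\<forall>i\<in>{1..npts D}. pick D i \<in> {1..nreg D}) \<and>
     (\<forall>i\<in>{1..npts D}.
        let k = pick D i in
        contractive_similitude_homeomorphism (region D k) (cell D i) (smap D i k) \<and>
        smap D i k ` {node D (lo D k), node D (hi D k)} = {node D (i - 1), node D i}) \<and>
     (\<forall>i\<in>{1..npts D}.
        admissible_coeff (cell D i) (c11 D i) \<and> admissible_coeff (cell D i) (c12 D i) \<and>
        admissible_coeff (cell D i) (c21 D i) \<and> admissible_coeff (cell D i) (c22 D i))"

text \<open>The affine interpolant of the values \<open>v p\<close>, \<open>v r\<close> at the nodes with indices \<open>p\<close>, \<open>r\<close>.\<close>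

definition chord :: "hvr_data \<Rightarrow> (nat \<Rightarrow> real) \<Rightarrow> nat \<Rightarrow> nat \<Rightarrow> real \<Rightarrow> real" where
  "chord D v p r u =
     (u - node D p) / (node D r - node D p) * v r + (u - node D r) / (node D p - node D r) * v p"

definition q1 :: "hvr_data \<Rightarrow> nat \<Rightarrow> nat \<Rightarrow> real \<Rightarrow> real" where
  "q1 D i k u =
     - c11 D i (smap D i k u) * chord D (yval D) (lo D k) (hi D k) u
     - c12 D i (smap D i k u) * chord D (zval D) (lo D k) (hi D k) u
     + chord D (yval D) (i - 1) i (smap D i k u)"

definition q2 :: "hvr_data \<Rightarrow> nat \<Rightarrow> nat \<Rightarrow> real \<Rightarrow> real" where
  "q2 D i k u =
     - c21 D i (smap D i k u) * chord D (yval D) (lo D k) (hi D k) u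
     - c22 D i (smap D i k u) * chord D (zval D) (lo D k) (hi D k) u
     + chord D (zval D) (i - 1) i (smap D i k u)"

text \<open>
  \<open>(f1, f2)\<close> is the vector-valued interpolation function of \<open>D\<close>, so \<open>f1\<close> is its HVRFIF. The
  predicate only constrains the values on \<open>[0, 1]\<close>.
\<close>

definition hvr_function :: "hvr_data \<Rightarrow> (real \<Rightarrow> real) \<Rightarrow> (real \<Rightarrow> real) \<Rightarrow> bool" where
  "hvr_function D f1 f2 \<longleftrightarrow>
     continuous_on {0..1} f1 \<and> continuous_on {0..1} f2 \<and>
     (\<forall>i\<le>npts D. f1 (node D i) = yval D i \<and> f2 (node D i) = zval D i) \<and>
     (\<forall>i\<in>{1..npts D}. \<forall>u\<in>cell D i.
        let k = pick D i; v = inv_into (region D k) (smap D i k) u in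
        f1 u = c11 D i u * f1 v + c12 D i u * f2 v + q1 D i k v \<and>
        f2 u = c21 D i u * f1 v + c22 D i u * f2 v + q2 D i k v)"

text \<open>
  The piecewise affine map taking the partition \<open>x\<close> to the partition \<open>x'\<close>. The index selects a cell
  containing \<open>u\<close>; by the lemma below its choice at a common endpoint of two cells is irrelevant.
\<close>

definition reparam :: "(nat \<Rightarrow> real) \<Rightarrow> (nat \<Rightarrow> real) \<Rightarrow> real \<Rightarrow> real" where
  "reparam x x' u =
     (let i = (LEAST i. 1 \<le> i \<and> u \<le> x i)
      in x' (i - 1) + (x' i - x' (i - 1)) / (x i - x (i - 1)) * (u - x (i - 1)))"

lemma reparam_eq:
  assumes x: "unit_partition n x" and i: "i \<in> {1..n}" and u: "u \<in> {x (i - 1)..x i}"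
  shows "reparam x x' u = x' (i - 1) + (x' i - x' (i - 1)) / (x i - x (i - 1)) * (u - x (i - 1))"
proof -
  have step: "x j < x (Suc j)" if "j < n" for j
    using x that unfolding unit_partition_def by (metis One_nat_def Suc_leI atLeastAtMost_iff
        diff_Suc_1 le_add1 plus_1_eq_Suc)
  have mono: "x j < x k" if "j < k" "k \<le> n" for j k
    using that
  proof (induction k)
    case (Suc k)
    then show ?case using step[of k] by (cases "j = k") auto
  qed simp
  define m where "m = (LEAST i. 1 \<le> i \<and> u \<le> x i)"
  have m: "1 \<le> m" "u \<le> x m"
    using LeastI[of "\<lambda>i. 1 \<le> i \<and> u \<le> x i" i] i u unfolding m_def by auto
  have le: "m \<le> i" unfolding m_def by (rule Least_le) (use i u in auto)
  have R: "reparam x x' u = x' (m - 1) + (x' m - x' (m - 1)) / (x m - x (m - 1)) * (u - x (m - 1))"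
    by (simp add: reparam_def Let_def m_def)
  show ?thesis
  proof (cases "m = i")
    case False
    with le have "m \<le> i - 1" by simp
    moreover have "\<not> m < i - 1"
      using mono[of m "i - 1"] m u i by fastforce
    ultimately have mi: "m = i - 1" by simp
    have "u = x m" using m u mi by auto
    moreover have "x (m - 1) < x m" using m le i mono[of "m - 1" m] by auto
    ultimately show ?thesis unfolding R using mi by simp
  qed (use R in simp)
qed

definition perturb :: "hvr_data \<Rightarrow> (nat \<Rightarrow> real) \<Rightarrow> hvr_data" where
  "perturb D x' =
     (let R = reparam (node D) x'; R' = inv_into {0..1} R in
      D\<lparr>node := x',
        smap := (\<lambda>i k. R \<circ> smap D i k \<circ> R'),
        c11 := (\<lambda>i. c11 D i \<circ> R'), c12 := (\<lambda>i. c12 D i \<circ> R'),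
        c21 := (\<lambda>i. c21 D i \<circ> R'), c22 := (\<lambda>i. c22 D i \<circ> R')\<rparr>)"

definition sup_on :: "real set \<Rightarrow> (real \<Rightarrow> real) \<Rightarrow> real" where
  "sup_on S g = (SUP u\<in>S. \<bar>g u\<bar>)"

definition omega :: "hvr_data \<Rightarrow> real" where
  "omega D = Max ((\<lambda>j. max (sup_on (cell D j) (c11 D j)) (sup_on (cell D j) (c12 D j))) ` {1..npts D})"

definition omega_tilde :: "hvr_data \<Rightarrow> real" where
  "omega_tilde D = Max ((\<lambda>j. max (sup_on (cell D j) (c21 D j)) (sup_on (cell D j) (c22 D j))) ` {1..npts D})"

definition length_ratio :: "hvr_data \<Rightarrow> nat \<Rightarrow> real" where
  "length_ratio D k =
     (node D k - node D (k - 1)) / (node D (hi D (pick D k)) - node D (lo D (pick D k)))"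

definition max_ratio :: "hvr_data \<Rightarrow> real" where
  "max_ratio D = Max (length_ratio D ` {1..npts D})"

definition min_ratio :: "hvr_data \<Rightarrow> real" where
  "min_ratio D = Min (length_ratio D ` {1..npts D})"

end

theory Submission
  imports Defs
begin

text \<open>
  With \<open>R\<close> the piecewise affine map between the partitions and \<open>Gj = gj \<circ> R\<close>, the functions
  \<open>(G1, G2)\<close> solve the functional equations of \<open>(f1, f2)\<close> up to the change of the chords over the
  regions, which is at most \<open>K \<delta>\<close> for \<open>\<delta> = max |x\<^sub>i - x'\<^sub>i|\<close> and a constant \<open>K\<close> depending on the
  unperturbed data only. Hence \<open>d = |f1 - G1| + |f2 - G2|\<close> satisfies
  \<open>d v \<le> (\<omega> + \<omega>~) (d w + K \<delta>)\<close>, where \<open>w\<close> is the preimage of \<open>v\<close>, and \<open>|f1 - G1| \<le> \<omega> (d w + K \<delta>)\<close>,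
  which gives \<open>|f1 - G1| \<le> \<omega> K \<delta> / (1 - \<omega> - \<omega>~)\<close>. The remaining term \<open>f1 - f1 \<circ> R\<inverse>\<close> is at most
  \<open>L1 \<delta> powr \<tau>1\<close> by Hoelder continuity, as \<open>R\<close> moves points by at most \<open>\<delta>\<close>.
\<close>

section \<open>Partitions of the unit interval and their cells\<close>

lemma unit_partition_less:
  assumes "unit_partition n x" "j < k" "k \<le> n"
  shows "x j < x k"
  using assms(2,3)
proof (induction k)
  case (Suc k)
  have "x k < x (Suc k)"
    using bspec[of "{1..n}" "\<lambda>i. x (i - 1) < x i" "Suc k"] assms(1) Suc.prems
    by (simp add: unit_partition_def)
  with Suc show ?case by (cases "j = k") auto
qed simp

lemma unit_partition_le:
  assumes "unit_partition n x" "j \<le> k" "k \<le> n"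
  shows "x j \<le> x k"
  using unit_partition_less[of n x j k] assms by (cases "j = k") auto

lemma unit_partition_mem:
  assumes "unit_partition n x" "j \<le> n"
  shows "x j \<in> {0..1}"
  using unit_partition_le[of n x 0 j] unit_partition_le[of n x j n] assms
  by (simp add: unit_partition_def)

lemma unit_partition_pos: "unit_partition n x \<Longrightarrow> 0 < n"
  by (cases n) (auto simp: unit_partition_def)

text \<open>Induction on \<open>r\<close> peels off the last cell: either \<open>u\<close> already
  lies in it, or \<open>u\<close> lies left of the node before it and the shorter range applies.
  With \<open>p > 0\<close> this locates a point of a region in one of the cells making up that
  region.\<close>

lemma ex_cell_between:
  fixes x :: "nat \<Rightarrow> real"
  assumes "p < r" "u \<in> {x p..x r}"
  shows "\<exists>i. p < i \<and> i \<le> r \<and> u \<in> {x (i - 1)..x i}"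
  using assms
proof (induction r)
  case (Suc r)
  show ?case
  proof (cases "x r \<le> u \<or> p = r")
    case True
    with Suc.prems show ?thesis by (intro exI[of _ "Suc r"]) auto
  next
    case False
    with Suc show ?thesis by force
  qed
qed simp

lemma unit_partition_ex_cell:
  assumes "unit_partition n x" "u \<in> {0..1}"
  shows "\<exists>i\<in>{1..n}. u \<in> {x (i - 1)..x i}"
  using ex_cell_between[of 0 n u x] unit_partition_pos[OF assms(1)] assms
  by (fastforce simp: unit_partition_def)

section \<open>The piecewise affine map between two partitions\<close>

text \<open>The weight \<open>t\<close> is the relative position of \<open>u\<close> in its cell,
  which an affine map between cells preserves. Claims about the map thus become claims about the
  nodes alone.\<close>

lemma reparam_convex_comb:
  assumes x: "unit_partition n x" and i: "i \<in> {1..n}" and u: "u \<in> {x (i - 1)..x i}"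
  obtains t where "0 \<le> t" "t \<le> 1" "u = (1 - t) * x (i - 1) + t * x i"
    "reparam x x' u = (1 - t) * x' (i - 1) + t * x' i"
proof
  have less: "x (i - 1) < x i"
    using x i by (simp add: unit_partition_def)
  define t where "t = (u - x (i - 1)) / (x i - x (i - 1))"
  have t: "t * (x i - x (i - 1)) = u - x (i - 1)"
    using less by (simp add: t_def)
  show "0 \<le> t" "t \<le> 1"
    using less u by (auto simp: t_def)
  show "u = (1 - t) * x (i - 1) + t * x i"
    using t by (simp add: algebra_simps)
  have "reparam x x' u = x' (i - 1) + (x' i - x' (i - 1)) * t"
    unfolding reparam_eq[OF x i u] t_def by simp
  then show "reparam x x' u = (1 - t) * x' (i - 1) + t * x' i"
    by (simp add: algebra_simps)
qed

lemma convex_comb_mem: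
  fixes a b t :: real
  assumes "0 \<le> t" "t \<le> 1" "a \<le> b"
  shows "(1 - t) * a + t * b \<in> {a..b}"
proof -
  have "0 \<le> t * (b - a)" "0 \<le> (1 - t) * (b - a)"
    using assms by simp_all
  then show ?thesis by (simp add: algebra_simps)
qed

lemma reparam_mem_cell:
  assumes x: "unit_partition n x" and x': "unit_partition n x'"
    and i: "i \<in> {1..n}" and u: "u \<in> {x (i - 1)..x i}"
  shows "reparam x x' u \<in> {x' (i - 1)..x' i}"
proof -
  have "x' (i - 1) \<le> x' i" using x' i by (auto intro: unit_partition_le)
  then show ?thesis
    using reparam_convex_comb[OF x i u, of x'] convex_comb_mem by metis
qed

lemma reparam_mem_between:
  assumes x: "unit_partition n x" and x': "unit_partition n x'"
    and "p < r" "r \<le> n" "u \<in> {x p..x r}"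
  shows "reparam x x' u \<in> {x' p..x' r}"
proof -
  obtain i where i: "p < i" "i \<le> r" "u \<in> {x (i - 1)..x i}"
    using ex_cell_between assms by blast
  have "reparam x x' u \<in> {x' (i - 1)..x' i}"
    using reparam_mem_cell[OF x x'] i assms(4) by auto
  moreover have "x' p \<le> x' (i - 1)" "x' i \<le> x' r"
    using i assms(4) by (auto intro!: unit_partition_le[OF x'])
  ultimately show ?thesis by auto
qed

lemma reparam_mem_unit:
  assumes x: "unit_partition n x" and x': "unit_partition n x'" and "u \<in> {0..1}"
  shows "reparam x x' u \<in> {0..1}"
  using reparam_mem_between[OF x x', of 0 n u] assms unit_partition_pos[OF x]
  by (simp add: unit_partition_def)

text \<open>A point of cell \<open>i\<close> stays in the cell of the same index, where the two
  affine formulas undo each other. Used in both directions, this makes the map a bijection of the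
  unit interval.\<close>

lemma reparam_inverse:
  assumes x: "unit_partition n x" and x': "unit_partition n x'" and "u \<in> {0..1}"
  shows "reparam x' x (reparam x x' u) = u"
proof -
  obtain i where i: "i \<in> {1..n}" and u: "u \<in> {x (i - 1)..x i}"
    using unit_partition_ex_cell[OF x] assms by blast
  have less: "x (i - 1) < x i" "x' (i - 1) < x' i"
    using x x' i by (simp_all add: unit_partition_def)
  show ?thesis
    unfolding reparam_eq[OF x' i reparam_mem_cell[OF x x' i u]]
    unfolding reparam_eq[OF x i u] using less by simp
qed

text \<open>A point and its image are the same convex combination of old and new nodes, so the
  displacement is that convex combination of the node displacements.\<close>

lemma reparam_displacement:
  assumes x: "unit_partition n x" and u: "u \<in> {0..1}"
    and \<delta>: "\<And>i. i \<le> n \<Longrightarrow> \<bar>x i - x' i\<bar> \<le> \<delta>"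
  shows "\<bar>u - reparam x x' u\<bar> \<le> \<delta>"
proof -
  obtain i where i: "i \<in> {1..n}" and "u \<in> {x (i - 1)..x i}"
    using unit_partition_ex_cell[OF x u] by blast
  from reparam_convex_comb[OF x this, of x'] obtain t where t: "0 \<le> t" "t \<le> 1"
    and u_eq: "u = (1 - t) * x (i - 1) + t * x i"
    and R_eq: "reparam x x' u = (1 - t) * x' (i - 1) + t * x' i" .
  have "u - reparam x x' u = (1 - t) * (x (i - 1) - x' (i - 1)) + t * (x i - x' i)"
    by (subst u_eq, subst R_eq) (simp add: algebra_simps)
  then have "\<bar>u - reparam x x' u\<bar> = \<bar>(1 - t) * (x (i - 1) - x' (i - 1)) + t * (x i - x' i)\<bar>"
    by simp
  also have "\<dots> \<le> (1 - t) * \<bar>x (i - 1) - x' (i - 1)\<bar> + t * \<bar>x i - x' i\<bar>"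
    using t by (metis abs_mult abs_of_nonneg abs_triangle_ineq diff_ge_0_iff_ge)
  also have "\<dots> \<le> (1 - t) * \<delta> + t * \<delta>"
    using t i by (intro add_mono mult_left_mono \<delta>) auto
  finally show ?thesis by (simp add: algebra_simps)
qed

section \<open>Chords under a change of nodes\<close>

lemma chord_eq:
  assumes "node D p \<noteq> node D r"
  shows "chord D v p r u = v p + (u - node D p) / (node D r - node D p) * (v r - v p)"
  using assms by (simp add: chord_def divide_simps) (simp add: algebra_simps)

text \<open>Over the common denominator \<open>b - a\<close> the numerator is a combination of the
  three displacements: \<open>w\<close> and \<open>a\<close> contribute \<open>\<delta>\<close>
  each, and the change of length, weighted by \<open>t \<le> 1\<close>, contributes
  \<open>2 * \<delta>\<close>. Keeping \<open>b - a\<close> rather than \<open>b' - a'\<close> below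
  makes the constant independent of the perturbed nodes.\<close>

lemma relative_position_perturb:
  fixes a b a' b' w w' \<delta> :: real
  assumes "a < b" "w' \<in> {a'..b'}" "a' < b'"
    and "\<bar>a - a'\<bar> \<le> \<delta>" "\<bar>b - b'\<bar> \<le> \<delta>" "\<bar>w - w'\<bar> \<le> \<delta>"
  shows "\<bar>(w - a) / (b - a) - (w' - a') / (b' - a')\<bar> \<le> 4 * \<delta> / (b - a)"
proof -
  define t where "t = (w' - a') / (b' - a')"
  have t: "0 \<le> t" "t \<le> 1" and t_eq: "t * (b' - a') = w' - a'"
    using assms by (auto simp: t_def)
  have "(w - a) / (b - a) - t = ((w - a) - t * (b - a)) / (b - a)"
    using assms by (simp add: field_simps)
  also have "(w - a) - t * (b - a) = (w - w') - (a - a') - t * ((b - b') - (a - a'))"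
    using t_eq by (simp add: algebra_simps)
  finally have eq: "\<bar>(w - a) / (b - a) - t\<bar>
      = \<bar>(w - w') - (a - a') - t * ((b - b') - (a - a'))\<bar> / (b - a)"
    using assms by simp
  have "\<bar>t * ((b - b') - (a - a'))\<bar> \<le> 1 * (2 * \<delta>)"
    unfolding abs_mult using assms t by (intro mult_mono) auto
  then have "\<bar>(w - w') - (a - a') - t * ((b - b') - (a - a'))\<bar> \<le> 4 * \<delta>"
    using assms by linarith
  then show ?thesis
    unfolding t_def[symmetric] eq using assms by (simp add: divide_right_mono)
qed

lemma chord_perturb:
  assumes "node D p < node D r" "node D' p < node D' r" "w' \<in> {node D' p..node D' r}"
    and "\<bar>node D p - node D' p\<bar> \<le> \<delta>" "\<bar>node D r - node D' r\<bar> \<le> \<delta>" "\<bar>w - w'\<bar> \<le> \<delta>"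
  shows "\<bar>chord D v p r w - chord D' v p r w'\<bar> \<le> 4 * \<bar>v r - v p\<bar> / (node D r - node D p) * \<delta>"
proof -
  have "\<bar>chord D v p r w - chord D' v p r w'\<bar>
      = \<bar>(w - node D p) / (node D r - node D p) - (w' - node D' p) / (node D' r - node D' p)\<bar>
        * \<bar>v r - v p\<bar>"
    using assms by (simp add: chord_eq abs_mult[symmetric] left_diff_distrib)
  also have "\<dots> \<le> 4 * \<delta> / (node D r - node D p) * \<bar>v r - v p\<bar>"
    using assms by (intro mult_right_mono relative_position_perturb) auto
  finally show ?thesis by (simp add: mult_ac)
qed

text \<open>Relative positions inside a cell are preserved exactly, so the chords over cells
  contribute no error; only the chords over regions do, since the map is merely piecewise affine
  there.\<close>

lemma chord_reparam:
  assumes x: "unit_partition (npts D) (node D)" and x': "unit_partition (npts D) (node D')"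
    and i: "i \<in> {1..npts D}" and u: "u \<in> cell D i"
  shows "chord D' v (i - 1) i (reparam (node D) (node D') u) = chord D v (i - 1) i u"
proof -
  have "node D (i - 1) < node D i" "node D' (i - 1) < node D' i"
    using x x' i by (simp_all add: unit_partition_def)
  then show ?thesis
    using reparam_eq[OF x i, of u "node D'"] u by (simp add: chord_eq cell_def)
qed

section \<open>Bounds on coefficient functions and length ratios\<close>

lemma abs_le_sup_on:
  assumes "admissible_coeff S c" "u \<in> S"
  shows "\<bar>c u\<bar> \<le> sup_on S c"
  unfolding sup_on_def using assms
  by (intro cSUP_upper bdd_aboveI2[where M = 1]) (auto simp: admissible_coeff_def less_imp_le)

lemma coeff_bounds:
  assumes D: "hvr_system D" and i: "i \<in> {1..npts D}" and u: "u \<in> cell D i"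
  shows "\<bar>c11 D i u\<bar> \<le> omega D" "\<bar>c12 D i u\<bar> \<le> omega D"
    and "\<bar>c21 D i u\<bar> \<le> omega_tilde D" "\<bar>c22 D i u\<bar> \<le> omega_tilde D"
proof -
  have adm: "admissible_coeff (cell D i) (c11 D i)" "admissible_coeff (cell D i) (c12 D i)"
    "admissible_coeff (cell D i) (c21 D i)" "admissible_coeff (cell D i) (c22 D i)"
    using D i by (simp_all add: hvr_system_def)
  have "max (sup_on (cell D i) (c11 D i)) (sup_on (cell D i) (c12 D i)) \<le> omega D"
    and "max (sup_on (cell D i) (c21 D i)) (sup_on (cell D i) (c22 D i)) \<le> omega_tilde D"
    unfolding omega_def omega_tilde_def using i by (intro Max_ge; simp del: max.bounded_iff)+
  with adm[THEN abs_le_sup_on, OF u]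
  show "\<bar>c11 D i u\<bar> \<le> omega D" "\<bar>c12 D i u\<bar> \<le> omega D"
    "\<bar>c21 D i u\<bar> \<le> omega_tilde D" "\<bar>c22 D i u\<bar> \<le> omega_tilde D"
    by linarith+
qed

lemma region_indices:
  assumes "hvr_system D" "k \<in> {1..nreg D}"
  shows "lo D k < hi D k" "hi D k \<le> npts D"
proof -
  have "\<forall>k\<in>{1..nreg D}. lo D k + 2 \<le> hi D k \<and> hi D k \<le> npts D"
    using assms(1) unfolding hvr_system_def by blast
  then have "lo D k + 2 \<le> hi D k \<and> hi D k \<le> npts D" using assms(2) by blast
  then show "lo D k < hi D k" "hi D k \<le> npts D" by simp_all
qed

text \<open>The ratio of cell 1 is positive and lies between the two extremes. This turns the
  smallness assumption of the theorem into the contraction bound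
  \<open>omega D + omega_tilde D < 1\<close>.\<close>

lemma min_ratio_div_max_ratio_le_1:
  assumes D: "hvr_system D"
  shows "min_ratio D / max_ratio D \<le> 1"
proof -
  have x: "unit_partition (npts D) (node D)" using D by (simp add: hvr_system_def)
  have 1: "1 \<in> {1..npts D}" using unit_partition_pos[OF x] by simp
  define k where "k = pick D 1"
  have "k \<in> {1..nreg D}" using D 1 by (simp add: hvr_system_def k_def)
  note region_indices[OF D this]
  then have "0 < length_ratio D 1"
    unfolding length_ratio_def k_def[symmetric]
    using x 1 by (intro divide_pos_pos) (auto simp: unit_partition_less)
  moreover have "min_ratio D \<le> length_ratio D 1" "length_ratio D 1 \<le> max_ratio D"
    unfolding min_ratio_def max_ratio_def using 1 by (auto intro!: Max_ge Min_le)
  ultimately show ?thesis by (simp add: divide_le_eq)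
qed

section \<open>Comparison through the two functional equations\<close>

text \<open>Shaped for one component of the comparison: \<open>p\<close>, \<open>q\<close> will be
  the component differences at the preimage, and \<open>r\<close>, \<open>s\<close> the changes of
  the two region chords.\<close>

lemma abs_two_term_le:
  fixes a b p q r s :: real
  assumes "\<bar>a\<bar> \<le> c" "\<bar>b\<bar> \<le> c" "\<bar>r\<bar> + \<bar>s\<bar> \<le> e"
  shows "\<bar>a * p + b * q - a * r - b * s\<bar> \<le> c * (\<bar>p\<bar> + \<bar>q\<bar> + e)"
proof -
  have "\<bar>a * p + b * q - a * r - b * s\<bar> \<le> \<bar>a\<bar> * \<bar>p\<bar> + \<bar>b\<bar> * \<bar>q\<bar> + \<bar>a\<bar> * \<bar>r\<bar> + \<bar>b\<bar> * \<bar>s\<bar>"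
    unfolding abs_mult[symmetric] by linarith
  also have "\<dots> \<le> c * \<bar>p\<bar> + c * \<bar>q\<bar> + c * \<bar>r\<bar> + c * \<bar>s\<bar>"
    using assms by (intro add_mono mult_right_mono) auto
  also have "\<dots> = c * (\<bar>p\<bar> + \<bar>q\<bar> + (\<bar>r\<bar> + \<bar>s\<bar>))" by (simp add: algebra_simps)
  also have "\<dots> \<le> c * (\<bar>p\<bar> + \<bar>q\<bar> + e)"
    using assms by (intro mult_left_mono) auto
  finally show ?thesis .
qed

text \<open>Subtracts the equation of the perturbed system at \<open>R v\<close> from that of
  \<open>D\<close> at \<open>v\<close>. The coefficients agree at these points and the cell chords
  cancel, leaving the differences at the preimage \<open>w\<close> and the region chords, all
  multiplied by coefficients.\<close>

lemma hvr_function_compare: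
  fixes f1 f2 g1 g2 :: "real \<Rightarrow> real"
  assumes D: "hvr_system D" and f: "hvr_function D f1 f2"
    and x': "unit_partition (npts D) x'" and g: "hvr_function (perturb D x') g1 g2"
    and \<delta>: "\<And>i. i \<le> npts D \<Longrightarrow> \<bar>node D i - x' i\<bar> \<le> \<delta>"
    and K: "\<And>k. k \<in> {1..nreg D} \<Longrightarrow>
      4 * \<bar>yval D (hi D k) - yval D (lo D k)\<bar> / (node D (hi D k) - node D (lo D k))
      + 4 * \<bar>zval D (hi D k) - zval D (lo D k)\<bar> / (node D (hi D k) - node D (lo D k)) \<le> K"
    and v: "v \<in> {0..1}"
  defines "R \<equiv> reparam (node D) x'"
  defines "d \<equiv> \<lambda>u. \<bar>f1 u - g1 (R u)\<bar> + \<bar>f2 u - g2 (R u)\<bar>"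
  shows "\<exists>w\<in>{0..1}. \<bar>f1 v - g1 (R v)\<bar> \<le> omega D * (d w + K * \<delta>) \<and>
                    \<bar>f2 v - g2 (R v)\<bar> \<le> omega_tilde D * (d w + K * \<delta>)"
proof -
  define D' where "D' = perturb D x'"
  define R' where "R' = inv_into {0..1} R"
  have x: "unit_partition (npts D) (node D)" using D by (simp add: hvr_system_def)
  have D'_simps: "npts D' = npts D" "node D' = x'" "yval D' = yval D" "zval D' = zval D"
    "lo D' = lo D" "hi D' = hi D" "pick D' = pick D"
    "smap D' = (\<lambda>i k. R \<circ> smap D i k \<circ> R')"
    "c11 D' = (\<lambda>i. c11 D i \<circ> R')" "c12 D' = (\<lambda>i. c12 D i \<circ> R')"
    "c21 D' = (\<lambda>i. c21 D i \<circ> R')" "c22 D' = (\<lambda>i. c22 D i \<circ> R')"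
    by (simp_all add: D'_def perturb_def R_def R'_def Let_def)
  have inj_R: "inj_on R {0..1}"
    unfolding R_def by (rule inj_on_inverseI[of _ "reparam x' (node D)"])
      (rule reparam_inverse[OF x x'])
  have R'R: "R' (R u) = u" if "u \<in> {0..1}" for u
    unfolding R'_def using inj_R that by (rule inv_into_f_f)
  \<comment> \<open>The abstract inverse in \<open>perturb\<close> is identified with the explicit
    map in the opposite direction, so the facts on \<open>reparam\<close> apply to it.\<close>
  have R': "R' u = reparam x' (node D) u" if "u \<in> {0..1}" for u
  proof -
    have "R (reparam x' (node D) u) = u"
      unfolding R_def using x' x that by (rule reparam_inverse)
    with R'R[OF reparam_mem_unit[OF x' x that]] show ?thesis by simp
  qed

  obtain i where i: "i \<in> {1..npts D}" and vi: "v \<in> cell D i"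
    using unit_partition_ex_cell[OF x v] by (auto simp: cell_def)
  define k where "k = pick D i"
  have k: "k \<in> {1..nreg D}" using D i by (simp add: hvr_system_def k_def)
  note lohi = region_indices[OF D k]
  define L where "L = smap D i k"
  have "contractive_similitude_homeomorphism (region D k) (cell D i) L"
    using D i unfolding hvr_system_def Let_def k_def L_def by blast
  then obtain Linv where "homeomorphism (region D k) (cell D i) L Linv"
    unfolding contractive_similitude_homeomorphism_def by blast
  then have inj_L: "inj_on L (region D k)" and L_img: "L ` region D k = cell D i"
    by (auto simp: homeomorphism_def intro: inj_on_inverseI)
  define w where "w = inv_into (region D k) L v"
  have w: "w \<in> region D k" and Lw: "L w = v"
    using inv_into_into[of v L "region D k"] f_inv_into_f[of v L "region D k"] vi L_img
    by (simp_all add: w_def)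
  have region_unit: "region D k \<subseteq> {0..1}" and region_unit': "region D' k \<subseteq> {0..1}"
    using unit_partition_mem[OF x, of "lo D k"] unit_partition_mem[OF x, of "hi D k"]
      unit_partition_mem[OF x', of "lo D k"] unit_partition_mem[OF x', of "hi D k"] lohi
    by (auto simp: region_def D'_simps)
  have cell_unit: "cell D i \<subseteq> {0..1}"
    using unit_partition_mem[OF x, of "i - 1"] unit_partition_mem[OF x, of i] i
    by (auto simp: cell_def)
  have w01: "w \<in> {0..1}" using w region_unit by blast
  have Rw: "R w \<in> region D' k"
    unfolding R_def region_def D'_simps
    using reparam_mem_between[OF x x' lohi] w by (simp add: region_def)
  have Rv: "R v \<in> cell D' i"
    unfolding R_def cell_def D'_simps
    using reparam_mem_cell[OF x x' i] vi by (simp add: cell_def)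
  have R'_mem: "R' u \<in> region D k" if "u \<in> region D' k" for u
    using R'[of u] reparam_mem_between[OF x' x lohi] that region_unit'
    by (auto simp: region_def D'_simps)
  \<comment> \<open>The perturbed equation is stated with \<open>inv_into\<close>; injectivity on
    the region forces the preimage of \<open>R v\<close> to be exactly \<open>R w\<close>.\<close>
  have "inj_on (smap D' i k) (region D' k)"
  proof (rule inj_onI)
    fix a b assume ab: "a \<in> region D' k" "b \<in> region D' k" "smap D' i k a = smap D' i k b"
    have "L (R' a) \<in> {0..1}" "L (R' b) \<in> {0..1}"
      using R'_mem ab L_img cell_unit by blast+
    moreover have "R (L (R' a)) = R (L (R' b))" using ab by (simp add: D'_simps L_def)
    ultimately have "L (R' a) = L (R' b)" using inj_R by (simp add: inj_on_eq_iff)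
    then have "R' a = R' b" using inj_L R'_mem ab by (simp add: inj_on_eq_iff)
    moreover have "reparam (node D) x' (R' u) = u" if "u \<in> region D' k" for u
      using reparam_inverse[OF x' x, of u] R'[of u] that region_unit' by auto
    ultimately show "a = b" using ab by metis
  qed
  moreover have "smap D' i k (R w) = R v"
    by (simp add: D'_simps R'R[OF w01] Lw L_def[symmetric])
  ultimately have inv': "inv_into (region D' k) (smap D' i k) (R v) = R w"
    using Rw by (intro inv_into_f_eq)

  have f_eq: "f1 v = c11 D i v * f1 w + c12 D i v * f2 w + q1 D i k w"
    "f2 v = c21 D i v * f1 w + c22 D i v * f2 w + q2 D i k w"
    using f i vi unfolding hvr_function_def Let_def w_def L_def k_def by blast+
  have g_eq: "g1 (R v) = c11 D' i (R v) * g1 (R w) + c12 D' i (R v) * g2 (R w) + q1 D' i k (R w)"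
    "g2 (R v) = c21 D' i (R v) * g1 (R w) + c22 D' i (R v) * g2 (R w) + q2 D' i k (R w)"
    using g i Rv inv' unfolding hvr_function_def Let_def D'_def[symmetric] D'_simps(1,7) k_def
    by metis+
  have coeff': "c11 D' i (R v) = c11 D i v" "c12 D' i (R v) = c12 D i v"
    "c21 D' i (R v) = c21 D i v" "c22 D' i (R v) = c22 D i v"
    by (simp_all add: D'_simps R'R[OF v])
  have h_eq: "chord D' val (i - 1) i (R v) = chord D val (i - 1) i v" for val
    using chord_reparam[OF x, of D' i v val] x' i vi by (simp add: D'_simps R_def)
  define r where "r = chord D (yval D) (lo D k) (hi D k) w - chord D' (yval D) (lo D k) (hi D k) (R w)"
  define s where "s = chord D (zval D) (lo D k) (hi D k) w - chord D' (zval D) (lo D k) (hi D k) (R w)"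
  have diff1: "f1 v - g1 (R v) = c11 D i v * (f1 w - g1 (R w)) + c12 D i v * (f2 w - g2 (R w))
      - c11 D i v * r - c12 D i v * s"
    unfolding f_eq g_eq coeff' q1_def \<open>smap D' i k (R w) = R v\<close> h_eq r_def s_def
    using Lw by (simp add: L_def D'_simps(3-6) coeff' h_eq algebra_simps)
  have diff2: "f2 v - g2 (R v) = c21 D i v * (f1 w - g1 (R w)) + c22 D i v * (f2 w - g2 (R w))
      - c21 D i v * r - c22 D i v * s"
    unfolding f_eq g_eq coeff' q2_def \<open>smap D' i k (R w) = R v\<close> h_eq r_def s_def
    using Lw by (simp add: L_def D'_simps(3-6) coeff' h_eq algebra_simps)

  have chord_diff: "\<bar>chord D val (lo D k) (hi D k) w - chord D' val (lo D k) (hi D k) (R w)\<bar>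
      \<le> 4 * \<bar>val (hi D k) - val (lo D k)\<bar> / (node D (hi D k) - node D (lo D k)) * \<delta>" for val
  proof (rule chord_perturb)
    show "\<bar>w - R w\<bar> \<le> \<delta>" unfolding R_def using reparam_displacement[OF x w01] \<delta> by blast
  qed (use lohi x x' \<delta> Rw in \<open>auto simp: D'_simps region_def intro: unit_partition_less\<close>)
  have "0 \<le> \<delta>" using \<delta>[of 0] by simp
  have "\<bar>r\<bar> + \<bar>s\<bar> \<le> K * \<delta>"
    using chord_diff[of "yval D"] chord_diff[of "zval D"] mult_right_mono[OF K[OF k] \<open>0 \<le> \<delta>\<close>]
    unfolding r_def s_def by (simp add: distrib_right)
  then have "\<bar>f1 v - g1 (R v)\<bar> \<le> omega D * (d w + K * \<delta>)"
    "\<bar>f2 v - g2 (R v)\<bar> \<le> omega_tilde D * (d w + K * \<delta>)"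
    unfolding diff1 diff2 d_def
    using coeff_bounds[OF D i vi] by (intro abs_two_term_le; simp)+
  with w01 show ?thesis by blast
qed

section \<open>Supremum estimate and the stability bound\<close>

lemma bounded_on_unit:
  fixes f :: "real \<Rightarrow> real"
  assumes "continuous_on {0..1} f"
  obtains B where "\<And>u. u \<in> {0..1} \<Longrightarrow> \<bar>f u\<bar> \<le> B"
  using compact_imp_bounded[OF compact_continuous_image[OF assms compact_Icc]]
  unfolding bounded_iff by (metis imageI real_norm_def)

text \<open>The supremum \<open>S'\<close> of \<open>d\<close> is finite and satisfies
  \<open>S' \<le> \<rho> * (S' + e)\<close>; as \<open>\<rho> < 1\<close>, this can be solved for
  \<open>S'\<close>. The bound \<open>B\<close> serves only to make the supremum finite and does not
  enter the estimate.\<close>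

lemma self_bounded_le:
  fixes d :: "'a \<Rightarrow> real"
  assumes bdd: "\<And>v. v \<in> S \<Longrightarrow> d v \<le> B"
    and step: "\<And>v. v \<in> S \<Longrightarrow> \<exists>w\<in>S. d v \<le> \<rho> * (d w + e)"
    and \<rho>: "0 \<le> \<rho>" "\<rho> < 1" and v: "v \<in> S"
  shows "d v \<le> \<rho> * e / (1 - \<rho>)"
proof -
  have bdd': "bdd_above (d ` S)" using bdd by (rule bdd_aboveI2)
  have "(SUP u\<in>S. d u) \<le> \<rho> * ((SUP u\<in>S. d u) + e)"
  proof (rule cSUP_least)
    fix u assume "u \<in> S"
    with step obtain w where w: "w \<in> S" "d u \<le> \<rho> * (d w + e)" by blast
    note w(2)
    also have "\<rho> * (d w + e) \<le> \<rho> * ((SUP u\<in>S. d u) + e)"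
      using \<rho> cSUP_upper[OF w(1) bdd'] by (intro mult_left_mono) auto
    finally show "d u \<le> \<rho> * ((SUP u\<in>S. d u) + e)" .
  qed (use v in auto)
  then have "(SUP u\<in>S. d u) \<le> \<rho> * e / (1 - \<rho>)"
    using \<rho> by (simp add: pos_le_divide_eq algebra_simps)
  with cSUP_upper[OF v bdd'] show ?thesis by linarith
qed

theorem theorem4:
  fixes D :: hvr_data and f1 f2 :: "real \<Rightarrow> real" and L1 L2 \<tau>1 \<tau>2 :: real
  assumes "hvr_system D"
    and "hvr_function D f1 f2"
    and "omega D + omega_tilde D < min_ratio D / max_ratio D"
    and "L1 > 0" and "L2 > 0"
    and "0 < \<tau>1" and "\<tau>1 \<le> 1" and "0 < \<tau>2" and "\<tau>2 \<le> 1"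
    and "\<And>u v. u \<in> {0..1} \<Longrightarrow> v \<in> {0..1} \<Longrightarrow> \<bar>f1 u - f1 v\<bar> \<le> L1 * \<bar>u - v\<bar> powr \<tau>1"
    and "\<And>u v. u \<in> {0..1} \<Longrightarrow> v \<in> {0..1} \<Longrightarrow> \<bar>f2 u - f2 v\<bar> \<le> L2 * \<bar>u - v\<bar> powr \<tau>2"
  shows "\<exists>N \<tau>. 0 < \<tau> \<and> \<tau> \<le> 1 \<and>
    (\<forall>x' g1 g2. unit_partition (npts D) x' \<longrightarrow> hvr_function (perturb D x') g1 g2 \<longrightarrow>
       sup_on {0..1} (\<lambda>u. f1 u - g1 u) \<le>
         (L1 * (1 + omega D - omega_tilde D) + 2 * omega D * L2 + omega D * N)
           / (1 - omega D - omega_tilde D)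
           * Max ((\<lambda>i. \<bar>node D i - x' i\<bar> powr \<tau>) ` {0..npts D}))"
proof -
  define slope where "slope = (\<lambda>k.
    4 * \<bar>yval D (hi D k) - yval D (lo D k)\<bar> / (node D (hi D k) - node D (lo D k))
    + 4 * \<bar>zval D (hi D k) - zval D (lo D k)\<bar> / (node D (hi D k) - node D (lo D k)))"
  \<comment> \<open>The sum of nonnegative terms is a common upper bound for the slopes.\<close>
  define K where "K = (\<Sum>k\<in>{1..nreg D}. slope k)"
  have x: "unit_partition (npts D) (node D)" using assms(1) by (simp add: hvr_system_def)
  have slope_nonneg: "0 \<le> slope k" if "k \<in> {1..nreg D}" for k
    using unit_partition_less[OF x region_indices[OF assms(1) that]] by (simp add: slope_def)
  then have slope_le: "slope k \<le> K" if "k \<in> {1..nreg D}" for k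
    unfolding K_def using that by (intro member_le_sum) auto
  have K_nonneg: "0 \<le> K" unfolding K_def using slope_nonneg by (intro sum_nonneg)
  \<comment> \<open>Both dominate the absolute value of a coefficient at the point 0 of cell
    1.\<close>
  have \<omega>: "0 \<le> omega D" "0 \<le> omega_tilde D"
    using coeff_bounds(1,3)[OF assms(1), of 1 0] unit_partition_pos[OF x] x
      unit_partition_le[OF x, of 0 1] abs_ge_zero order_trans
    by (fastforce simp: cell_def unit_partition_def)+
  have lt1: "omega D + omega_tilde D < 1"
    using assms(3) min_ratio_div_max_ratio_le_1[OF assms(1)] by linarith

  show ?thesis
  \<comment> \<open>\<open>N\<close> is the chord constant \<open>K\<close> and
    \<open>\<tau>\<close> the Hoelder exponent of \<open>f1\<close>; both are fixed before the
    perturbed nodes are introduced.\<close>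
  proof (rule exI[of _ K], rule exI[of _ \<tau>1], intro conjI allI impI)
    fix x' g1 g2
    assume x': "unit_partition (npts D) x'" and g: "hvr_function (perturb D x') g1 g2"
    define \<delta> where "\<delta> = Max ((\<lambda>i. \<bar>node D i - x' i\<bar>) ` {0..npts D})"
    define M where "M = Max ((\<lambda>i. \<bar>node D i - x' i\<bar> powr \<tau>1) ` {0..npts D})"
    have \<delta>_ge: "\<bar>node D i - x' i\<bar> \<le> \<delta>" if "i \<le> npts D" for i
      unfolding \<delta>_def using that by (intro Max_ge) auto
    have "\<delta> \<in> (\<lambda>i. \<bar>node D i - x' i\<bar>) ` {0..npts D}"
      unfolding \<delta>_def by (intro Max_in) auto
    then obtain j where j: "j \<le> npts D" "\<delta> = \<bar>node D j - x' j\<bar>" by auto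
    have \<delta>01: "0 \<le> \<delta>" "\<delta> \<le> 1"
      using j unit_partition_mem[OF x j(1)] unit_partition_mem[OF x' j(1)] by auto
    have powr_M: "\<delta> powr \<tau>1 \<le> M"
      unfolding M_def j(2) using j(1) by (intro Max_ge) auto
    \<comment> \<open>On the unit interval a power with exponent at most 1 dominates its base. The
      chord error, linear in \<open>\<delta>\<close>, is thereby absorbed into the Hoelder scale
      \<open>M\<close>.\<close>
    have \<delta>_M: "\<delta> \<le> M"
      using powr_mono'[of \<tau>1 1 \<delta>] \<delta>01 assms(7) powr_M by simp
    define R where "R = reparam (node D) x'"
    define d where "d = (\<lambda>u. \<bar>f1 u - g1 (R u)\<bar> + \<bar>f2 u - g2 (R u)\<bar>)"
    have compare: "\<exists>w\<in>{0..1}. \<bar>f1 v - g1 (R v)\<bar> \<le> omega D * (d w + K * \<delta>) \<and>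
        \<bar>f2 v - g2 (R v)\<bar> \<le> omega_tilde D * (d w + K * \<delta>)" if "v \<in> {0..1}" for v
      using hvr_function_compare[OF assms(1,2) x' g \<delta>_ge slope_le[unfolded slope_def] that]
      unfolding d_def R_def by simp

    obtain B1 B2 C1 C2 where "\<And>u. u \<in> {0..1} \<Longrightarrow> \<bar>f1 u\<bar> \<le> B1" "\<And>u. u \<in> {0..1} \<Longrightarrow> \<bar>f2 u\<bar> \<le> B2"
      "\<And>u. u \<in> {0..1} \<Longrightarrow> \<bar>g1 u\<bar> \<le> C1" "\<And>u. u \<in> {0..1} \<Longrightarrow> \<bar>g2 u\<bar> \<le> C2"
      using assms(2) g bounded_on_unit unfolding hvr_function_def by metis
    note bounds = this
    have d_bdd: "d v \<le> B1 + C1 + B2 + C2" if "v \<in> {0..1}" for v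
      using bounds(1,2)[OF that] bounds(3,4)[OF reparam_mem_unit[OF x x' that]]
      unfolding d_def R_def by linarith
    define E where "E = (omega D + omega_tilde D) * (K * \<delta>) / (1 - (omega D + omega_tilde D))"
    have d_le: "d v \<le> E" if "v \<in> {0..1}" for v
      unfolding E_def
    proof (rule self_bounded_le[OF d_bdd _ _ lt1 that])
      fix u :: real assume "u \<in> {0..1}"
      from compare[OF this] show "\<exists>w\<in>{0..1}. d u \<le> (omega D + omega_tilde D) * (d w + K * \<delta>)"
        unfolding d_def distrib_right[of "omega D"] by (meson add_mono)
    qed (use \<omega> in auto)
    \<comment> \<open>One more use of the comparison, now for the first component alone, leaves the
      factor \<open>omega D\<close> in place of the sum of both.\<close>
    have E_eq: "E + K * \<delta> = K * \<delta> / (1 - omega D - omega_tilde D)"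
      using lt1 by (simp add: E_def field_simps)
    have f1_le: "\<bar>f1 v - g1 (R v)\<bar> \<le> omega D * (K * \<delta> / (1 - omega D - omega_tilde D))"
      if "v \<in> {0..1}" for v
    proof -
      obtain w where w: "w \<in> {0..1}" "\<bar>f1 v - g1 (R v)\<bar> \<le> omega D * (d w + K * \<delta>)"
        using compare \<open>v \<in> {0..1}\<close> by blast
      note w(2)
      also have "omega D * (d w + K * \<delta>) \<le> omega D * (E + K * \<delta>)"
        using \<omega> d_le[OF w(1)] by (intro mult_left_mono) auto
      finally show ?thesis unfolding E_eq .
    qed

    have "\<bar>f1 u - g1 u\<bar> \<le> (L1 * (1 + omega D - omega_tilde D) + 2 * omega D * L2 + omega D * K)
           / (1 - omega D - omega_tilde D) * M" if u: "u \<in> {0..1}" for u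
    proof -
      \<comment> \<open>With \<open>R v = u\<close>, the error splits into
        \<open>f1 u - f1 v\<close>, controlled by Hoelder continuity, and
        \<open>f1 v - g1 (R v)\<close>, controlled by \<open>f1_le\<close>.\<close>
      define v where "v = reparam x' (node D) u"
      have v: "v \<in> {0..1}" unfolding v_def using x' x u by (rule reparam_mem_unit)
      have Rv: "R v = u" unfolding R_def v_def using x' x u by (rule reparam_inverse)
      have "\<bar>u - v\<bar> \<le> \<delta>"
        unfolding v_def using \<delta>_ge by (intro reparam_displacement[OF x' u]) (simp add: abs_minus_commute)
      then have "\<bar>u - v\<bar> powr \<tau>1 \<le> M"
        using powr_mono2[of \<tau>1 "\<bar>u - v\<bar>" \<delta>] assms(6) powr_M by simp
      then have "\<bar>f1 u - f1 v\<bar> \<le> L1 * M"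
        using assms(10)[OF u v] assms(4) by (meson mult_left_mono less_imp_le order_trans)
      moreover have "\<bar>f1 v - g1 u\<bar> \<le> omega D * (K * M / (1 - omega D - omega_tilde D))"
      proof -
        have "\<bar>f1 v - g1 u\<bar> \<le> omega D * (K * \<delta> / (1 - omega D - omega_tilde D))"
          using f1_le[OF v] Rv by simp
        also have "\<dots> \<le> omega D * (K * M / (1 - omega D - omega_tilde D))"
          using \<omega> K_nonneg \<delta>_M lt1 by (intro mult_left_mono divide_right_mono) auto
        finally show ?thesis .
      qed
      ultimately have "\<bar>f1 u - g1 u\<bar> \<le> L1 * M + omega D * (K * M / (1 - omega D - omega_tilde D))"
        by linarith
      also have "\<dots> = (L1 * (1 - omega D - omega_tilde D) + omega D * K)
           / (1 - omega D - omega_tilde D) * M"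
        using lt1 by (simp add: field_simps)
      \<comment> \<open>The numerator grows by \<open>2 * omega D * (L1 + L2)\<close>, which is
        nonnegative.\<close>
      also have "\<dots> \<le> (L1 * (1 + omega D - omega_tilde D) + 2 * omega D * L2 + omega D * K)
           / (1 - omega D - omega_tilde D) * M"
      proof (intro mult_right_mono divide_right_mono)
        have "L1 * (1 - omega D - omega_tilde D) \<le> L1 * (1 + omega D - omega_tilde D)"
          using \<omega> assms(4) by (intro mult_left_mono) auto
        moreover have "0 \<le> 2 * omega D * L2" using \<omega> assms(5) by simp
        ultimately show "L1 * (1 - omega D - omega_tilde D) + omega D * K
          \<le> L1 * (1 + omega D - omega_tilde D) + 2 * omega D * L2 + omega D * K" by linarith
      qed (use lt1 \<delta>_M \<delta>01 in auto)
      finally show ?thesis .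
    qed
    then show "sup_on {0..1} (\<lambda>u. f1 u - g1 u) \<le>
         (L1 * (1 + omega D - omega_tilde D) + 2 * omega D * L2 + omega D * K)
           / (1 - omega D - omega_tilde D)
           * Max ((\<lambda>i. \<bar>node D i - x' i\<bar> powr \<tau>1) ` {0..npts D})"
      unfolding sup_on_def M_def[symmetric] by (intro cSUP_least) auto
  qed (use assms(6,7) in auto)
qed

end
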